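(* Let $\mathbf{k}$ be an algebraically closed field. The map $$\alpha \longmapsto \mathbf{k}[[t^{\mathbb{Q}}]]^+ + (y-\alpha)\,\mathbf{k}[[t^{\mathbb{Q}}]][y]$$ is a bijection from $\mathbf{k}[[t^{\mathbb{Q}}]]^+$ onto the set of extending maximal $\mathbf{k}$-subalgebras of $\mathbf{k}[[t^{\mathbb{Q}}]][y]$ that contain $\mathbf{k}[[t^{\mathbb{Q}}]]^+[y]$.
   Context: All rings are commutative with unity. A proper subring $A \subsetneq R$ is a maximal subring if there is no ring strictly between $A$ and $R$; a maximal $\mathbf{k}$-subalgebra is a maximal subring that is a $\mathbf{k}$-subalgebra. A maximal subring $A \subsetneq R$ is called extending if $\operatorname{Spec}(R) \to \operatorname{Spec}(A)$ is not surjective. $\mathbf{k}[[t^{\mathbb{Q}}]]$ denotes the Hahn field over $\mathbf{k}$ with rational exponents, i.e. the field of formal power series $\alpha = \sum_{s \in \mathbb{Q}} a_s t^s$ with $a_s \in \mathbf{k}$ whose support $\operatorname{supp}(\alpha) = \{ s \in \mathbb{Q} \mid a_s \neq 0\}$ is well ordered. $\mathbf{k}[[t^{\mathbb{Q}}]]^+$ is the subring of those $\alpha$ with $\operatorname{supp}(\alpha) \subseteq [0,\infty)$. *)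

theory Defs
  imports "HOL-Algebra.Algebraic_Closure_Type" "HOL-Library.Set_Algebras"
begin

section \<open>Well-ordered subsets of a linear order\<close>

definition well_ordered :: "'a::linorder set \<Rightarrow> bool"
  where "well_ordered S \<longleftrightarrow> well_order_on S {(x, y) \<in> S \<times> S. x \<le> y}"

lemma well_ordered_iff_wf:
  "well_ordered S \<longleftrightarrow> wf {(x, y) \<in> S \<times> S. x < y}"
proof -
  have 1: "linear_order_on S {(x, y) \<in> S \<times> S. x \<le> y}"
    by (auto simp: order_on_defs refl_on_def trans_def antisym_def total_on_def)
  have 2: "{(x, y) \<in> S \<times> S. x \<le> y} - Id = {(x, y) \<in> S \<times> S. x < y}"
    by auto
  show ?thesis
    unfolding well_ordered_def well_order_on_def 2 using 1 by simp
qed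

lemma well_ordered_iff_least:
  "well_ordered S \<longleftrightarrow> (\<forall>T\<subseteq>S. T \<noteq> {} \<longrightarrow> (\<exists>m\<in>T. \<forall>x\<in>T. m \<le> x))"
proof
  assume S: "well_ordered S"
  show "\<forall>T\<subseteq>S. T \<noteq> {} \<longrightarrow> (\<exists>m\<in>T. \<forall>x\<in>T. m \<le> x)"
  proof (intro allI impI)
    fix T assume T: "T \<subseteq> S" "T \<noteq> {}"
    then obtain m where "m \<in> T" "\<And>y. (y, m) \<in> {(x, y) \<in> S \<times> S. x < y} \<Longrightarrow> y \<notin> T"
      using S[unfolded well_ordered_iff_wf wf_eq_minimal] by blast
    with T show "\<exists>m\<in>T. \<forall>x\<in>T. m \<le> x"
      by (intro bexI[of _ m]) (auto simp: not_less[symmetric])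
  qed
next
  assume *: "\<forall>T\<subseteq>S. T \<noteq> {} \<longrightarrow> (\<exists>m\<in>T. \<forall>x\<in>T. m \<le> x)"
  show "well_ordered S"
    unfolding well_ordered_iff_wf wf_eq_minimal
  proof (intro allI impI)
    fix Q :: "'a set" and x assume x: "x \<in> Q"
    show "\<exists>z\<in>Q. \<forall>y. (y, z) \<in> {(x, y) \<in> S \<times> S. x < y} \<longrightarrow> y \<notin> Q"
    proof (cases "Q \<inter> S = {}")
      case True
      with x show ?thesis by blast
    next
      case False
      then obtain m where "m \<in> Q \<inter> S" "\<forall>x\<in>Q \<inter> S. m \<le> x"
        using * by (meson inf_le2)
      then show ?thesis by (intro bexI[of _ m]) (auto simp: not_less[symmetric])
    qed
  qed
qed

lemma well_ordered_subset: "well_ordered S \<Longrightarrow> T \<subseteq> S \<Longrightarrow> well_ordered T"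
  unfolding well_ordered_iff_least by (meson order_trans)

lemma well_ordered_empty [simp]: "well_ordered {}"
  by (simp add: well_ordered_iff_least)

lemma well_ordered_singleton [simp]: "well_ordered {x}"
  by (auto simp: well_ordered_iff_least)

lemma well_ordered_Un:
  assumes "well_ordered S" "well_ordered T"
  shows "well_ordered (S \<union> T)"
  unfolding well_ordered_iff_least
proof (intro allI impI)
  fix U assume U: "U \<subseteq> S \<union> T" "U \<noteq> {}"
  have S: "U \<inter> S = {} \<or> (\<exists>m\<in>U \<inter> S. \<forall>x\<in>U \<inter> S. m \<le> x)"
    using assms(1) unfolding well_ordered_iff_least by (meson inf_le2)
  have T: "U \<inter> T = {} \<or> (\<exists>m\<in>U \<inter> T. \<forall>x\<in>U \<inter> T. m \<le> x)"
    using assms(2) unfolding well_ordered_iff_least by (meson inf_le2)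
  consider "U \<inter> S = {}" | "U \<inter> T = {}"
    | m n where "m \<in> U \<inter> S" "\<forall>x\<in>U \<inter> S. m \<le> x" "n \<in> U \<inter> T" "\<forall>x\<in>U \<inter> T. n \<le> x"
    using S T by blast
  then show "\<exists>m\<in>U. \<forall>x\<in>U. m \<le> x"
  proof cases
    case 1
    then have "U \<inter> T = U" using U by blast
    with T U show ?thesis by auto
  next
    case 2
    then have "U \<inter> S = U" using U by blast
    with S U show ?thesis by auto
  next
    case 3
    have "min m n \<in> U" using 3 by (auto simp: min_def)
    moreover have "\<forall>x\<in>U. min m n \<le> x" using 3 U by (auto simp: min_le_iff_disj)
    ultimately show ?thesis by blast
  qed
qed

lemma finite_if_least_and_greatest:
  fixes S :: "'a::linorder set"
  assumes least: "\<And>T. T \<subseteq> S \<Longrightarrow> T \<noteq> {} \<Longrightarrow> \<exists>m\<in>T. \<forall>x\<in>T. m \<le> x"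
    and greatest: "\<And>T. T \<subseteq> S \<Longrightarrow> T \<noteq> {} \<Longrightarrow> \<exists>m\<in>T. \<forall>x\<in>T. x \<le> m"
  shows "finite S"
proof (rule ccontr)
  assume inf: "infinite S"
  define T where "T = {x \<in> S. infinite (S \<inter> {..x})}"
  obtain M where M: "M \<in> S" "\<forall>x\<in>S. x \<le> M"
    using greatest[of S] inf by auto
  then have "S \<inter> {..M} = S" by auto
  with inf M have "M \<in> T" by (simp add: T_def)
  then obtain m where m: "m \<in> T" "\<forall>x\<in>T. m \<le> x"
    using least[of T] unfolding T_def by blast
  have "S \<inter> {..m} \<subseteq> insert m (S \<inter> {..<m})" by auto
  with m have inf': "infinite (S \<inter> {..<m})"
    unfolding T_def by (auto dest: finite_subset)
  then obtain m' where m': "m' \<in> S \<inter> {..<m}" "\<forall>x\<in>S \<inter> {..<m}. x \<le> m'"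
    using greatest[of "S \<inter> {..<m}"] by (metis finite.emptyI inf_le1)
  then have "S \<inter> {..<m} \<subseteq> S \<inter> {..m'}" by auto
  with inf' have "infinite (S \<inter> {..m'})" using finite_subset by blast
  with m' have "m' \<in> T" unfolding T_def by auto
  with m m' show False by fastforce
qed

lemma finite_decompositions:
  fixes A B :: "'a::linordered_ab_group_add set"
  assumes A: "well_ordered A" and B: "well_ordered B"
  shows "finite {a \<in> A. s - a \<in> B}"
proof (rule finite_if_least_and_greatest)
  fix T assume T: "T \<subseteq> {a \<in> A. s - a \<in> B}" "T \<noteq> {}"
  then have "T \<subseteq> A" by auto
  with A T show "\<exists>m\<in>T. \<forall>x\<in>T. m \<le> x" unfolding well_ordered_iff_least by blast
  have "(\<lambda>x. s - x) ` T \<subseteq> B" "(\<lambda>x. s - x) ` T \<noteq> {}" using T by auto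
  then obtain b where "b \<in> (\<lambda>x. s - x) ` T" "\<forall>x\<in>(\<lambda>x. s - x) ` T. b \<le> x"
    using B unfolding well_ordered_iff_least by blast
  then obtain m where "m \<in> T" "\<forall>x\<in>T. x \<le> m" by auto
  then show "\<exists>m\<in>T. \<forall>x\<in>T. x \<le> m" by blast
qed

lemma well_ordered_no_chain:
  assumes "well_ordered S" "\<And>i::nat. f i \<in> S"
  shows "\<not> (\<forall>i. f (Suc i) < f i)"
  using assms unfolding well_ordered_iff_wf wf_iff_no_infinite_down_chain by fastforce

lemma well_ordered_set_plus:
  fixes A B :: "'a::linordered_ab_group_add set"
  assumes A: "well_ordered A" and B: "well_ordered B"
  shows "well_ordered (A + B)"
proof (rule ccontr)
  assume "\<not> well_ordered (A + B)"
  then obtain f where f: "\<And>i::nat. f i \<in> A + B" "\<And>i. f (Suc i) < f i"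
    unfolding well_ordered_iff_wf wf_iff_no_infinite_down_chain by blast
  have f_anti: "f j < f i" if "i < j" for i j
    using that
  proof (induction j)
    case (Suc j)
    then show ?case using f(2)[of j] by (cases "i = j") auto
  qed simp
  have "\<forall>i. \<exists>a\<in>A. f i - a \<in> B"
  proof
    fix i
    obtain a b where "f i = a + b" "a \<in> A" "b \<in> B"
      using f(1)[of i] by (rule set_plus_elim)
    then show "\<exists>a\<in>A. f i - a \<in> B" by (intro bexI[of _ a]) auto
  qed
  then obtain a where a: "\<And>i. a i \<in> A" "\<And>i. f i - a i \<in> B" by metis
  have ex: "\<exists>m\<ge>k. \<forall>j\<ge>k. a m \<le> a j" for k
  proof -
    have "a ` {k..} \<subseteq> A" "a ` {k..} \<noteq> {}" using a(1) by auto
    then obtain m where "m \<in> a ` {k..}" "\<forall>x\<in>a ` {k..}. m \<le> x"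
      using A unfolding well_ordered_iff_least by blast
    then show ?thesis by auto
  qed
  then obtain n where n: "\<And>k. n k \<ge> k" "\<And>k j. j \<ge> k \<Longrightarrow> a (n k) \<le> a j" by metis
  define g where "g = rec_nat (n 0) (\<lambda>_ i. n (Suc i))"
  have g_Suc: "g (Suc i) = n (Suc (g i))" for i by (simp add: g_def)
  have g_less: "g i < g (Suc i)" for i
    using n(1)[of "Suc (g i)"] by (simp add: g_Suc)
  have "\<exists>k. g i = n k" for i by (cases i) (auto simp: g_def)
  then have g_mono: "a (g i) \<le> a (g (Suc i))" for i
    using n g_less[of i] by (metis less_imp_le order_trans)
  have "f (g (Suc i)) - a (g (Suc i)) < f (g i) - a (g i)" for i
    using f_anti[OF g_less[of i]] g_mono[of i] by (rule less_le_trans[OF diff_strict_right_mono diff_left_mono])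
  with well_ordered_no_chain[OF B, of "\<lambda>i. f (g i) - a (g i)"] a(2) show False by blast
qed


section \<open>Hahn series with rational exponents\<close>

typedef (overloaded) 'a hahn = "{f :: rat \<Rightarrow> 'a::zero. well_ordered {s. f s \<noteq> 0}}"
  morphisms hahn_nth Abs_hahn
  by (rule exI[of _ "\<lambda>_. 0"]) simp

setup_lifting type_definition_hahn

definition hahn_supp :: "'a::zero hahn \<Rightarrow> rat set"
  where "hahn_supp \<alpha> = {s. hahn_nth \<alpha> s \<noteq> 0}"

lemma well_ordered_hahn_supp: "well_ordered (hahn_supp \<alpha>)"
  using hahn_nth[of \<alpha>] by (simp add: hahn_supp_def)

lemma hahn_eqI: "(\<And>s. hahn_nth \<alpha> s = hahn_nth \<beta> s) \<Longrightarrow> \<alpha> = \<beta>"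
  by (simp add: hahn_nth_inject[symmetric] fun_eq_iff)

lemma supp_convolution:
  fixes f g :: "rat \<Rightarrow> 'a::semiring_0"
  shows "{s. (\<Sum>a | f a \<noteq> 0 \<and> g (s - a) \<noteq> 0. f a * g (s - a)) \<noteq> 0} \<subseteq> {s. f s \<noteq> 0} + {s. g s \<noteq> 0}"
proof
  fix s
  assume "s \<in> {s. (\<Sum>a | f a \<noteq> 0 \<and> g (s - a) \<noteq> 0. f a * g (s - a)) \<noteq> 0}"
  then have "{a. f a \<noteq> 0 \<and> g (s - a) \<noteq> 0} \<noteq> {}" by (auto simp del: Collect_empty_eq)
  then obtain a where "f a \<noteq> 0" "g (s - a) \<noteq> 0" by blast
  then have "a + (s - a) \<in> {s. f s \<noteq> 0} + {s. g s \<noteq> 0}" by (intro set_plus_intro) auto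
  then show "s \<in> {s. f s \<noteq> 0} + {s. g s \<noteq> 0}" by simp
qed

text \<open>
  The index set of the sum defining the product below is finite by \<open>finite_decompositions\<close>.
\<close>

instantiation hahn :: (comm_ring_1) comm_ring_1
begin

lift_definition zero_hahn :: "'a hahn" is "\<lambda>_. 0" by simp

lift_definition one_hahn :: "'a hahn" is "\<lambda>s. if s = 0 then 1 else 0" by simp

lift_definition plus_hahn :: "'a hahn \<Rightarrow> 'a hahn \<Rightarrow> 'a hahn" is "\<lambda>f g s. f s + g s"
proof -
  fix f g :: "rat \<Rightarrow> 'a"
  assume "well_ordered {s. f s \<noteq> 0}" "well_ordered {s. g s \<noteq> 0}"
  then have "well_ordered ({s. f s \<noteq> 0} \<union> {s. g s \<noteq> 0})"
    by (rule well_ordered_Un)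
  then show "well_ordered {s. f s + g s \<noteq> 0}"
    by (rule well_ordered_subset) auto
qed

lift_definition uminus_hahn :: "'a hahn \<Rightarrow> 'a hahn" is "\<lambda>f s. - f s" by simp

lift_definition minus_hahn :: "'a hahn \<Rightarrow> 'a hahn \<Rightarrow> 'a hahn" is "\<lambda>f g s. f s - g s"
proof -
  fix f g :: "rat \<Rightarrow> 'a"
  assume "well_ordered {s. f s \<noteq> 0}" "well_ordered {s. g s \<noteq> 0}"
  then have "well_ordered ({s. f s \<noteq> 0} \<union> {s. g s \<noteq> 0})"
    by (rule well_ordered_Un)
  then show "well_ordered {s. f s - g s \<noteq> 0}"
    by (rule well_ordered_subset) auto
qed

lift_definition times_hahn :: "'a hahn \<Rightarrow> 'a hahn \<Rightarrow> 'a hahn"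
  is "\<lambda>f g s. \<Sum>a | f a \<noteq> 0 \<and> g (s - a) \<noteq> 0. f a * g (s - a)"
proof -
  fix f g :: "rat \<Rightarrow> 'a"
  assume "well_ordered {s. f s \<noteq> 0}" "well_ordered {s. g s \<noteq> 0}"
  then have "well_ordered ({s. f s \<noteq> 0} + {s. g s \<noteq> 0})"
    by (rule well_ordered_set_plus)
  then show "well_ordered {s. (\<Sum>a | f a \<noteq> 0 \<and> g (s - a) \<noteq> 0. f a * g (s - a)) \<noteq> 0}"
    by (rule well_ordered_subset) (rule supp_convolution)
qed

lemma hahn_nth_times:
  assumes A: "well_ordered A" "hahn_supp \<alpha> \<subseteq> A" and B: "well_ordered B" "hahn_supp \<beta> \<subseteq> B"
  shows "hahn_nth (\<alpha> * \<beta>) s = (\<Sum>a | a \<in> A \<and> s - a \<in> B. hahn_nth \<alpha> a * hahn_nth \<beta> (s - a))"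
  unfolding times_hahn.rep_eq
  by (rule sum.mono_neutral_left[OF finite_decompositions[OF A(1) B(1)]])
    (use A(2) B(2) in \<open>auto simp: hahn_supp_def\<close>)

lemma hahn_supp_times: "hahn_supp (\<alpha> * \<beta>) \<subseteq> hahn_supp \<alpha> + hahn_supp \<beta>"
  unfolding hahn_supp_def times_hahn.rep_eq by (rule supp_convolution)

instance
proof
  fix \<alpha> \<beta> \<gamma> :: "'a hahn"
  show "\<alpha> + \<beta> + \<gamma> = \<alpha> + (\<beta> + \<gamma>)" by transfer (simp add: add.assoc)
  show "\<alpha> + \<beta> = \<beta> + \<alpha>" by transfer (simp add: add.commute)
  show "0 + \<alpha> = \<alpha>" by transfer simp
  show "- \<alpha> + \<alpha> = 0" by transfer simp
  show "\<alpha> - \<beta> = \<alpha> + - \<beta>" by transfer simp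
  show "(0::'a hahn) \<noteq> 1" by transfer (auto simp: fun_eq_iff)
  show "1 * \<alpha> = \<alpha>"
  proof (rule hahn_eqI)
    fix s
    have "{a. (if a = 0 then 1 else 0) \<noteq> (0::'a) \<and> hahn_nth \<alpha> (s - a) \<noteq> 0}
        = (if hahn_nth \<alpha> s = 0 then {} else {0})"
      by auto
    then show "hahn_nth (1 * \<alpha>) s = hahn_nth \<alpha> s"
      by (simp add: times_hahn.rep_eq one_hahn.rep_eq del: if_cancel)
  qed
  show "\<alpha> * \<beta> = \<beta> * \<alpha>"
  proof (rule hahn_eqI)
    fix s
    show "hahn_nth (\<alpha> * \<beta>) s = hahn_nth (\<beta> * \<alpha>) s"
      unfolding times_hahn.rep_eq
      by (rule sum.reindex_bij_witness[of _ "\<lambda>a. s - a" "\<lambda>a. s - a"]) (auto simp: mult.commute)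
  qed
  show "(\<alpha> + \<beta>) * \<gamma> = \<alpha> * \<gamma> + \<beta> * \<gamma>"
  proof (rule hahn_eqI)
    fix s
    let ?A = "hahn_supp \<alpha> \<union> hahn_supp \<beta>" and ?C = "hahn_supp \<gamma>"
    have A: "well_ordered ?A" by (intro well_ordered_Un well_ordered_hahn_supp)
    have C: "well_ordered ?C" by (rule well_ordered_hahn_supp)
    have sub: "hahn_supp (\<alpha> + \<beta>) \<subseteq> ?A" by (auto simp: hahn_supp_def plus_hahn.rep_eq)
    show "hahn_nth ((\<alpha> + \<beta>) * \<gamma>) s = hahn_nth (\<alpha> * \<gamma> + \<beta> * \<gamma>) s"
      unfolding plus_hahn.rep_eq[of "\<alpha> * \<gamma>"] hahn_nth_times[OF A sub C order_refl]
        hahn_nth_times[OF A Un_upper1 C order_refl] hahn_nth_times[OF A Un_upper2 C order_refl]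
      by (simp add: plus_hahn.rep_eq distrib_right sum.distrib)
  qed
  show "\<alpha> * \<beta> * \<gamma> = \<alpha> * (\<beta> * \<gamma>)"
  proof (rule hahn_eqI)
    fix s
    let ?A = "hahn_supp \<alpha>" and ?B = "hahn_supp \<beta>" and ?C = "hahn_supp \<gamma>"
    note wo = well_ordered_hahn_supp
    note AB = well_ordered_set_plus[OF wo wo]
    have "hahn_nth (\<alpha> * \<beta> * \<gamma>) s
        = (\<Sum>c | c \<in> ?A + ?B \<and> s - c \<in> ?C. \<Sum>a | a \<in> ?A \<and> c - a \<in> ?B.
            hahn_nth \<alpha> a * hahn_nth \<beta> (c - a) * hahn_nth \<gamma> (s - c))"
      unfolding hahn_nth_times[OF AB hahn_supp_times wo order_refl]
        hahn_nth_times[OF wo order_refl wo order_refl, of \<alpha> \<beta>]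
      by (simp add: sum_distrib_right)
    also have "\<dots> = (\<Sum>(c, a)\<in>(SIGMA c:{c. c \<in> ?A + ?B \<and> s - c \<in> ?C}. {a. a \<in> ?A \<and> c - a \<in> ?B}).
            hahn_nth \<alpha> a * hahn_nth \<beta> (c - a) * hahn_nth \<gamma> (s - c))"
      by (rule sum.Sigma) (auto intro: finite_decompositions AB wo)
    also have "\<dots> = (\<Sum>(a, b)\<in>(SIGMA a:{a. a \<in> ?A \<and> s - a \<in> ?B + ?C}. {b. b \<in> ?B \<and> s - a - b \<in> ?C}).
            hahn_nth \<alpha> a * (hahn_nth \<beta> b * hahn_nth \<gamma> (s - a - b)))"
    proof (rule sum.reindex_bij_witness[of _ "\<lambda>(a, b). (a + b, a)" "\<lambda>(c, a). (a, c - a)"],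
        goal_cases)
      case (2 x)
      obtain c a where x: "x = (c, a)" by (cases x)
      have "(c - a) + (s - c) \<in> ?B + ?C" using 2 x by (intro set_plus_intro) auto
      with 2 x show ?case by auto
    next
      case (4 x)
      obtain a b where x: "x = (a, b)" by (cases x)
      have "a + b \<in> ?A + ?B" using 4 x by (intro set_plus_intro) auto
      with 4 x show ?case by (auto simp: algebra_simps)
    qed (auto simp: algebra_simps)
    also have "\<dots> = (\<Sum>a | a \<in> ?A \<and> s - a \<in> ?B + ?C. \<Sum>b | b \<in> ?B \<and> s - a - b \<in> ?C.
            hahn_nth \<alpha> a * (hahn_nth \<beta> b * hahn_nth \<gamma> (s - a - b)))"
      by (rule sum.Sigma[symmetric]) (auto intro: finite_decompositions AB wo)
    also have "\<dots> = hahn_nth (\<alpha> * (\<beta> * \<gamma>)) s"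
      unfolding hahn_nth_times[OF wo order_refl AB hahn_supp_times]
        hahn_nth_times[OF wo order_refl wo order_refl, of \<beta> \<gamma>]
      by (simp add: sum_distrib_left)
    finally show "hahn_nth (\<alpha> * \<beta> * \<gamma>) s = hahn_nth (\<alpha> * (\<beta> * \<gamma>)) s" .
  qed
qed

end

lift_definition hahn_const :: "'a::zero \<Rightarrow> 'a hahn" is "\<lambda>c s. if s = 0 then c else 0"
  by (rule well_ordered_subset[of "{0}"]) auto

definition hahn_nonneg :: "'a::zero hahn set"
  where "hahn_nonneg = {\<alpha>. hahn_supp \<alpha> \<subseteq> {0..}}"


section \<open>Maximal subrings and extending subrings\<close>

definition maximal_subring :: "'a set \<Rightarrow> ('a, 'b) ring_scheme \<Rightarrow> bool"
  where "maximal_subring A R \<longleftrightarrow>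
    subring A R \<and> A \<subset> carrier R \<and> \<not> (\<exists>B. subring B R \<and> A \<subset> B \<and> B \<subset> carrier R)"

definition maximal_subalgebra :: "'a set \<Rightarrow> 'a set \<Rightarrow> ('a, 'b) ring_scheme \<Rightarrow> bool"
  where "maximal_subalgebra K A R \<longleftrightarrow> maximal_subring A R \<and> subalgebra K A R"

definition Spec :: "('a, 'b) ring_scheme \<Rightarrow> 'a set set"
  where "Spec R = {P. primeideal P R}"

text \<open>
  Contraction \<open>P \<mapsto> P \<inter> A\<close> is the map from \<open>Spec R\<close> to \<open>Spec A\<close> induced by the inclusion.
  The notion is applied to maximal subrings only; maximality is stated separately.
\<close>

definition extending :: "'a set \<Rightarrow> ('a, 'b) ring_scheme \<Rightarrow> bool"
  where "extending A R \<longleftrightarrow> \<not> Spec (R\<lparr>carrier := A\<rparr>) \<subseteq> (\<lambda>P. P \<inter> A) ` Spec R"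


section \<open>The polynomial ring over the Hahn series\<close>

abbreviation hahn_poly_ring :: "'a::comm_ring_1 hahn poly ring"
  where "hahn_poly_ring \<equiv> ring_of_type_algebra"

text \<open>
  The coefficient field as the subring of constants, and the image of the polynomial ring
  over \<^const>\<open>hahn_nonneg\<close>.
\<close>

definition hahn_poly_consts :: "'a::comm_ring_1 hahn poly set"
  where "hahn_poly_consts = range (\<lambda>c. [:hahn_const c:])"

definition hahn_nonneg_polys :: "'a::comm_ring_1 hahn poly set"
  where "hahn_nonneg_polys = {p. \<forall>i. poly.coeff p i \<in> hahn_nonneg}"

end

theory Submission
  imports Defs
begin

text \<open>
  Write \<open>K\<close> for the Hahn field and \<open>O\<close> for its valuation ring. The set attached to \<open>\<alpha>\<close> is
  \<open>{p. p(\<alpha>) \<in> O}\<close>, which is maximal because \<open>O\<close> has rank one and hence is maximal in \<open>K\<close>; it is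
  extending because the prime \<open>{p. v(p(\<alpha>)) > 0}\<close> contains \<open>t\<close>, a unit of \<open>K[y]\<close>.
  Conversely let \<open>A\<close> be a maximal subring containing \<open>O[y]\<close>. Then \<open>A \<inter> K = O\<close>, and Chevalley's
  argument shows that \<open>x y \<in> A\<close> implies \<open>x \<in> A\<close> or \<open>y \<in> A\<close>. The balls \<open>a + t\<^sup>s O\<close> with
  \<open>(y - a) / t\<^sup>s \<in> A\<close> are pairwise nested, so by spherical completeness of \<open>K\<close> they have a common
  point \<open>\<alpha>\<close>. As \<open>K\<close> is algebraically closed, any \<open>p \<in> A\<close> splits into linear factors, and
  distributing the valuation over the factors gives \<open>p(\<alpha>) \<in> O\<close>; hence \<open>A = {p. p(\<alpha>) \<in> O}\<close>.
  Algebraic closedness of \<open>K\<close> follows from spherical completeness too: were \<open>p\<close> without roots,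
  a Newton step would shrink the intersection of any maximal chain of balls centred at approximate
  roots.
\<close>


section \<open>Order of Hahn series\<close>

text \<open>The monomial t^s.\<close>

lift_definition hahn_power :: "rat \<Rightarrow> 'a::comm_ring_1 hahn" is "\<lambda>s q. if q = s then 1 else 0"
  by (rule well_ordered_subset[of "{s}" for s]) auto

text \<open>The fractional ideal t^s O. Working with these sets instead of a valuation avoids a
  value at 0.\<close>

definition hahn_ge :: "rat \<Rightarrow> 'a::zero hahn set"
  where "hahn_ge s = {x. \<forall>q<s. hahn_nth x q = 0}"

lemma hahn_nonneg_eq: "hahn_nonneg = hahn_ge 0"
  by (force simp: hahn_nonneg_def hahn_ge_def hahn_supp_def)

lemma hahn_ge_nth: "x \<in> hahn_ge s \<Longrightarrow> q < s \<Longrightarrow> hahn_nth x q = 0"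
  by (simp add: hahn_ge_def)

lemma hahn_ge_mono: "x \<in> hahn_ge s \<Longrightarrow> r \<le> s \<Longrightarrow> x \<in> hahn_ge r"
  by (auto simp: hahn_ge_def)

lemma zero_hahn_ge [simp]: "0 \<in> hahn_ge s"
  by (simp add: hahn_ge_def zero_hahn.rep_eq)

lemma one_hahn_ge [simp]: "1 \<in> hahn_ge 0"
  by (simp add: hahn_ge_def one_hahn.rep_eq)

lemma hahn_const_ge [simp]: "hahn_const c \<in> hahn_ge 0"
  by (simp add: hahn_ge_def hahn_const.rep_eq)

lemma hahn_ge_add: "x \<in> hahn_ge s \<Longrightarrow> y \<in> hahn_ge s \<Longrightarrow> x + y \<in> hahn_ge s"
  by (simp add: hahn_ge_def plus_hahn.rep_eq)

lemma hahn_ge_diff: "x \<in> hahn_ge s \<Longrightarrow> y \<in> hahn_ge s \<Longrightarrow> x - y \<in> hahn_ge s"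
  by (simp add: hahn_ge_def minus_hahn.rep_eq)

lemma hahn_ge_uminus: "x \<in> hahn_ge s \<Longrightarrow> - x \<in> hahn_ge s"
  by (simp add: hahn_ge_def uminus_hahn.rep_eq)

lemma hahn_ge_mult:
  assumes "x \<in> hahn_ge s" "y \<in> hahn_ge r"
  shows "x * y \<in> hahn_ge (s + r)"
proof -
  have "hahn_nth (x * y) q = 0" if "q < s + r" for q
  proof -
    have "{a. hahn_nth x a \<noteq> 0 \<and> hahn_nth y (q - a) \<noteq> 0} = {}"
    proof -
      have "a < s \<or> q - a < r" for a using that by linarith
      then show ?thesis using assms by (auto simp: hahn_ge_def)
    qed
    then show ?thesis by (simp only: times_hahn.rep_eq sum.empty)
  qed
  then show ?thesis by (simp add: hahn_ge_def)
qed

text \<open>At the sum of the two bounds only the index \<open>s\<close> survives: below it the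
  first factor vanishes, above it the second one. For \<open>s = r = 0\<close> this makes the
  residue map multiplicative on O.\<close>

lemma hahn_nth_mult_ge:
  assumes "x \<in> hahn_ge s" "y \<in> hahn_ge r"
  shows "hahn_nth (x * y) (s + r) = hahn_nth x s * hahn_nth y r"
proof -
  have "{a. hahn_nth x a \<noteq> 0 \<and> hahn_nth y (s + r - a) \<noteq> 0} =
      (if hahn_nth x s \<noteq> 0 \<and> hahn_nth y r \<noteq> 0 then {s} else {})"
  proof -
    have "a = s" if "hahn_nth x a \<noteq> 0" "hahn_nth y (s + r - a) \<noteq> 0" for a
    proof -
      have "\<not> a < s" "\<not> s + r - a < r" using that assms by (auto simp: hahn_ge_def)
      then show ?thesis by simp
    qed
    then have "hahn_nth x a \<noteq> 0 \<and> hahn_nth y (s + r - a) \<noteq> 0 \<longleftrightarrow>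
        a = s \<and> hahn_nth x s \<noteq> 0 \<and> hahn_nth y r \<noteq> 0" for a
      by (cases "a = s") auto
    then show ?thesis by auto
  qed
  then show ?thesis by (auto simp: times_hahn.rep_eq)
qed

lemma hahn_nth_power_mult [simp]: "hahn_nth (hahn_power s * x) q = hahn_nth x (q - s)"
proof -
  have "{a. hahn_nth (hahn_power s :: 'a hahn) a \<noteq> 0 \<and> hahn_nth x (q - a) \<noteq> 0} =
      (if hahn_nth x (q - s) = 0 then {} else {s})"
    by (auto simp: hahn_power.rep_eq)
  then show ?thesis by (simp add: times_hahn.rep_eq hahn_power.rep_eq del: if_cancel)
qed

lemma hahn_power_mult [simp]: "hahn_power s * hahn_power r = hahn_power (s + r)"
  by (rule hahn_eqI) (auto simp: hahn_power.rep_eq)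

lemma hahn_power_mult_left [simp]: "hahn_power s * (hahn_power r * x) = hahn_power (s + r) * x"
  by (simp flip: mult.assoc)

lemma hahn_power_0 [simp]: "hahn_power 0 = 1"
  by (rule hahn_eqI) (simp add: hahn_power.rep_eq one_hahn.rep_eq)

lemma hahn_power_power: "hahn_power s ^ n = hahn_power (of_nat n * s)"
  by (induction n) (simp_all add: algebra_simps)

lemma hahn_power_mult_ge_iff [simp]:
  "hahn_power s * x \<in> hahn_ge r \<longleftrightarrow> x \<in> hahn_ge (r - s)"
proof -
  have "(\<forall>q<r. hahn_nth x (q - s) = 0) \<longleftrightarrow> (\<forall>q<r - s. hahn_nth x q = 0)"
    by (metis add_diff_cancel_right' diff_add_cancel diff_strict_right_mono less_diff_eq)
  then show ?thesis by (simp add: hahn_ge_def)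
qed

lemma hahn_power_ge_iff [simp]: "hahn_power s \<in> hahn_ge r \<longleftrightarrow> r \<le> s"
  by (auto simp: hahn_ge_def hahn_power.rep_eq not_less)

lemma hahn_nonzero_order:
  assumes "x \<noteq> 0"
  obtains v where "x \<in> hahn_ge v" "hahn_nth x v \<noteq> 0"
proof -
  have "hahn_supp x \<noteq> {}"
    using assms hahn_eqI[of x 0] by (auto simp: hahn_supp_def zero_hahn.rep_eq)
  then obtain v where "v \<in> hahn_supp x" "\<forall>q\<in>hahn_supp x. v \<le> q"
    using well_ordered_hahn_supp[of x] unfolding well_ordered_iff_least by blast
  then show ?thesis
    by (intro that[of v]) (force simp: hahn_supp_def hahn_ge_def)+
qed

text \<open>A ball a + t^s O prescribes exactly the coefficients below \<open>s\<close>. Nested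
  balls agree wherever two of them prescribe a coefficient, so the prescriptions glue to one series;
  coefficients that no ball prescribes are set to 0.\<close>

lemma hahn_spherically_complete:
  fixes S :: "('a::comm_ring_1 hahn \<times> rat) set"
  assumes nested: "\<And>a s b r. (a, s) \<in> S \<Longrightarrow> (b, r) \<in> S \<Longrightarrow> s \<le> r \<Longrightarrow> b - a \<in> hahn_ge s"
  obtains \<alpha> where "\<And>a s. (a, s) \<in> S \<Longrightarrow> \<alpha> - a \<in> hahn_ge s"
proof -
  have agree: "hahn_nth a q = hahn_nth b q" if "(a, s) \<in> S" "(b, r) \<in> S" "q < s" "q < r" for a s b r q
    using nested[of a s b r] nested[of b r a s] that
    by (cases "s \<le> r") (auto simp: hahn_ge_def minus_hahn.rep_eq)
  define f where "f q = (if \<exists>a s. (a, s) \<in> S \<and> q < s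
    then hahn_nth (fst (SOME x. x \<in> S \<and> q < snd x)) q else 0)" for q
  have f: "f q = hahn_nth a q" if "(a, s) \<in> S" "q < s" for a s q
  proof -
    have "(SOME x. x \<in> S \<and> q < snd x) \<in> S \<and> q < snd (SOME x. x \<in> S \<and> q < snd x)"
      by (rule someI[of _ "(a, s)"]) (use that in auto)
    then show ?thesis
      using that agree[of "fst (SOME x. x \<in> S \<and> q < snd x)" "snd (SOME x. x \<in> S \<and> q < snd x)" a s q]
      by (auto simp: f_def)
  qed
  have wo: "well_ordered {q. f q \<noteq> 0}"
    unfolding well_ordered_iff_least
  proof (intro allI impI)
    fix T assume T: "T \<subseteq> {q. f q \<noteq> 0}" "T \<noteq> {}"
    then obtain q where q: "q \<in> T" "f q \<noteq> 0" by blast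
    then obtain a s where as: "(a, s) \<in> S" "q < s" by (metis f_def)
    \<comment> \<open>Up to \<open>q\<close> the glued series coincides with the single series
      \<open>a\<close>, whose support is well ordered.\<close>
    have "T \<inter> {..q} \<subseteq> hahn_supp a" "T \<inter> {..q} \<noteq> {}"
      using T q f[OF as(1)] as(2) by (auto simp: hahn_supp_def)
    then obtain m where "m \<in> T \<inter> {..q}" "\<forall>x\<in>T \<inter> {..q}. m \<le> x"
      using well_ordered_hahn_supp[of a, unfolded well_ordered_iff_least] by meson
    moreover from this have "m \<le> x" if "x \<in> T" for x
      using that by (cases "x \<le> q") auto
    ultimately show "\<exists>m\<in>T. \<forall>x\<in>T. m \<le> x" by blast
  qed
  then have "hahn_nth (Abs_hahn f) = f" by (simp add: Abs_hahn_inverse)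
  then show ?thesis using f by (intro that[of "Abs_hahn f"]) (auto simp: hahn_ge_def minus_hahn.rep_eq)
qed


section \<open>Subrings\<close>

definition is_subring :: "'a::comm_ring_1 set \<Rightarrow> bool"
  where "is_subring A \<longleftrightarrow> 1 \<in> A \<and> (\<forall>x\<in>A. \<forall>y\<in>A. x - y \<in> A \<and> x * y \<in> A)"

lemma is_subringD:
  assumes "is_subring A"
  shows "1 \<in> A" "0 \<in> A" "x \<in> A \<Longrightarrow> - x \<in> A"
    "x \<in> A \<Longrightarrow> y \<in> A \<Longrightarrow> x - y \<in> A"
    "x \<in> A \<Longrightarrow> y \<in> A \<Longrightarrow> x + y \<in> A"
    "x \<in> A \<Longrightarrow> y \<in> A \<Longrightarrow> x * y \<in> A"
    "x \<in> A \<Longrightarrow> x ^ n \<in> A"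
proof -
  note A = assms[unfolded is_subring_def]
  show 1: "1 \<in> A" using A by blast
  show d: "x - y \<in> A" if "x \<in> A" "y \<in> A" for x y using A that by blast
  show 0: "0 \<in> A" using d[OF 1 1] by simp
  show m: "- x \<in> A" if "x \<in> A" for x using d[OF 0 that] by simp
  show "x + y \<in> A" if "x \<in> A" "y \<in> A" using d[OF that(1) m[OF that(2)]] by simp
  show t: "x * y \<in> A" if "x \<in> A" "y \<in> A" for x y using A that by blast
  show "x ^ n \<in> A" if "x \<in> A" by (induction n) (simp_all add: 1 t that)
qed

lemma is_subring_sum:
  assumes "is_subring A" "\<And>i. i \<in> I \<Longrightarrow> f i \<in> A"
  shows "sum f I \<in> A"
  using assms(2)
  by (induction I rule: infinite_finite_induct) (auto intro: is_subringD[OF assms(1)])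

lemma is_subring_coeff_mult:
  assumes A: "is_subring A" and "\<And>i. poly.coeff p i \<in> A" "\<And>i. poly.coeff q i \<in> A"
  shows "poly.coeff (p * q) i \<in> A"
  unfolding coeff_mult by (intro is_subring_sum[OF A] is_subringD(6)[OF A] assms)

lemma subring_ring_of_type_algebra_iff:
  "subring A (ring_of_type_algebra :: 'a::comm_ring_1 ring) \<longleftrightarrow> is_subring A"
proof -
  interpret R: ring "ring_of_type_algebra :: 'a ring" ..
  have carr: "carrier (ring_of_type_algebra :: 'a ring) = UNIV"
    and ops: "x \<oplus>\<^bsub>ring_of_type_algebra\<^esub> y = x + y" "x \<otimes>\<^bsub>ring_of_type_algebra\<^esub> y = x * y"
      "\<zero>\<^bsub>ring_of_type_algebra\<^esub> = (0::'a)" "\<one>\<^bsub>ring_of_type_algebra\<^esub> = (1::'a)" for x y :: 'a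
    by (simp_all add: ring_of_type_algebra_def)
  have inv: "\<ominus>\<^bsub>ring_of_type_algebra\<^esub> x = - x" for x :: 'a
    by (rule R.minus_equality) (simp_all add: carr ops)
  show ?thesis
  proof
    assume "subring A (ring_of_type_algebra :: 'a ring)"
    note S = subringE[OF this, unfolded ops inv]
    show "is_subring A"
      unfolding is_subring_def by (metis S(3,5,6,7) diff_conv_add_uminus)
  next
    assume "is_subring A"
    note S = is_subringD[OF this]
    show "subring A (ring_of_type_algebra :: 'a ring)"
      by (rule R.subringI) (auto simp: carr ops inv S)
  qed
qed

lemma is_subring_hahn_nonneg: "is_subring (hahn_nonneg :: 'a::comm_ring_1 hahn set)"
  using hahn_ge_mult[of _ 0 _ 0] by (auto simp: is_subring_def hahn_nonneg_eq hahn_ge_diff)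

text \<open>An element of negative order yields a monomial t^d with \<open>d < 0\<close>, and the
  powers of t^d reach every negative order because the exponents are archimedean.\<close>

lemma hahn_nonneg_maximal:
  fixes B :: "'a::field hahn set"
  assumes B: "is_subring B" and sub: "hahn_nonneg \<subseteq> B" and b: "b \<in> B" "b \<notin> hahn_nonneg"
  shows "B = UNIV"
proof -
  have ge0: "x \<in> B" if "x \<in> hahn_ge 0" for x using sub that by (auto simp: hahn_nonneg_eq)
  have "b \<noteq> 0" using b by (auto simp: hahn_nonneg_eq)
  then obtain v where v: "b \<in> hahn_ge v" "hahn_nth b v \<noteq> 0" by (rule hahn_nonzero_order)
  have "v < 0" using v(1) b(2) hahn_ge_mono[of b v 0] by (force simp: hahn_nonneg_eq)
  define u where "u = hahn_const (hahn_nth b v) * hahn_power v"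
  have nth_u: "hahn_nth u q = (if q = v then hahn_nth b v else 0)" for q
    by (simp add: u_def hahn_const.rep_eq mult.commute[of "hahn_const _"])
  \<comment> \<open>\<open>e\<close> separates the leading term \<open>u\<close> from the rest of
    \<open>b\<close>: multiplication by t^(-e), an element of O, moves the rest into O but leaves
    the leading term of negative order. This isolates the leading monomial inside \<open>B\<close>
    without inverting a series.\<close>
  obtain e where e: "v < e" "e \<le> 0" "b - u \<in> hahn_ge e"
  proof (cases "b - u = 0")
    case True
    then show ?thesis using that[of 0] \<open>v < 0\<close> by simp
  next
    case False
    then obtain w where w: "b - u \<in> hahn_ge w" "hahn_nth (b - u) w \<noteq> 0" by (rule hahn_nonzero_order)
    have "w \<noteq> v" using w(2) by (auto simp: minus_hahn.rep_eq nth_u)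
    moreover have "\<not> w < v" using w(2) v(1) by (auto simp: minus_hahn.rep_eq nth_u hahn_ge_def)
    ultimately show ?thesis
      using that[of "min w 0"] hahn_ge_mono[OF w(1), of "min w 0"] \<open>v < 0\<close> by simp
  qed
  define d where "d = v - e"
  have d: "d < 0" using e by (simp add: d_def)
  have "hahn_power (- e) * b \<in> B"
    using e by (intro is_subringD(6)[OF B] b ge0) simp
  moreover have "hahn_power (- e) * (b - u) \<in> B"
    using e by (intro ge0) simp
  ultimately have "hahn_power (- e) * b - hahn_power (- e) * (b - u) \<in> B"
    by (rule is_subringD(4)[OF B])
  then have "hahn_power (- e) * u \<in> B" by (simp add: algebra_simps)
  then have "hahn_const (inverse (hahn_nth b v)) * (hahn_power (- e) * u) \<in> B"
    by (rule is_subringD(6)[OF B ge0[OF hahn_const_ge]])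
  moreover have "hahn_const (inverse (hahn_nth b v)) * (hahn_power (- e) * u) = hahn_power d"
  proof -
    have "hahn_const (inverse (hahn_nth b v)) * hahn_const (hahn_nth b v) = (1 :: 'a hahn)"
    proof (rule hahn_eqI)
      fix s
      have *: "{a. hahn_nth (hahn_const (inverse (hahn_nth b v))) a \<noteq> 0 \<and>
          hahn_nth (hahn_const (hahn_nth b v)) (s - a) \<noteq> 0} = (if s = 0 then {0} else {})"
        using v(2) by (auto simp: hahn_const.rep_eq)
      show "hahn_nth (hahn_const (inverse (hahn_nth b v)) * hahn_const (hahn_nth b v)) s = hahn_nth 1 s"
        unfolding times_hahn.rep_eq * using v(2) by (auto simp: hahn_const.rep_eq one_hahn.rep_eq)
    qed
    moreover have "hahn_const (inverse (hahn_nth b v)) * (hahn_power (- e) * u)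
      = (hahn_const (inverse (hahn_nth b v)) * hahn_const (hahn_nth b v)) * (hahn_power (- e) * hahn_power v)"
      by (simp only: u_def mult_ac)
    ultimately show ?thesis by (simp add: d_def)
  qed
  ultimately have pd: "hahn_power d \<in> B" by simp
  have "x \<in> B" for x
  proof (cases "x = 0")
    case True
    then show ?thesis by (simp add: is_subringD[OF B])
  next
    case False
    then obtain w where w: "x \<in> hahn_ge w" by (rule hahn_nonzero_order)
    obtain n :: nat where n: "- w / - d < of_nat n" using reals_Archimedean2 by blast
    then have n: "of_nat n * d \<le> w" using d by (simp add: field_simps)
    have "hahn_power d ^ n * (hahn_power (- (of_nat n * d)) * x) \<in> B"
      by (intro is_subringD(6,7)[OF B] pd ge0) (use hahn_ge_mono[OF w n] in simp)
    then show ?thesis by (simp add: hahn_power_power)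
  qed
  then show ?thesis by blast
qed


section \<open>The Hahn field is algebraically closed\<close>

definition hahn_red_poly :: "'a::comm_ring_1 hahn poly \<Rightarrow> 'a poly"
  where "hahn_red_poly = map_poly (\<lambda>x. hahn_nth x 0)"

lemma coeff_hahn_red_poly [simp]: "poly.coeff (hahn_red_poly p) i = hahn_nth (poly.coeff p i) 0"
  by (simp add: hahn_red_poly_def coeff_map_poly zero_hahn.rep_eq)

lemma hahn_nonneg_polys_iff: "p \<in> hahn_nonneg_polys \<longleftrightarrow> (\<forall>i. poly.coeff p i \<in> hahn_ge 0)"
  by (simp add: hahn_nonneg_polys_def hahn_nonneg_eq)

lemma hahn_nonneg_polys_mult:
  "p \<in> hahn_nonneg_polys \<Longrightarrow> q \<in> hahn_nonneg_polys \<Longrightarrow> p * q \<in> hahn_nonneg_polys"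
  unfolding hahn_nonneg_polys_def
  by (auto intro: is_subring_coeff_mult[OF is_subring_hahn_nonneg])

lemma hahn_nonneg_polys_pCons:
  "pCons a p \<in> hahn_nonneg_polys \<longleftrightarrow> a \<in> hahn_ge 0 \<and> p \<in> hahn_nonneg_polys"
  by (auto simp: hahn_nonneg_polys_iff coeff_pCons split: nat.splits)

lemma zero_hahn_nonneg_polys [simp]: "0 \<in> hahn_nonneg_polys"
  by (simp add: hahn_nonneg_polys_iff)

lemma hahn_nonneg_polys_add:
  "p \<in> hahn_nonneg_polys \<Longrightarrow> q \<in> hahn_nonneg_polys \<Longrightarrow> p + q \<in> hahn_nonneg_polys"
  by (simp add: hahn_nonneg_polys_iff hahn_ge_add)

lemma hahn_nth_sum: "hahn_nth (sum f I) s = (\<Sum>i\<in>I. hahn_nth (f i) s)"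
  by (induction I rule: infinite_finite_induct) (simp_all add: zero_hahn.rep_eq plus_hahn.rep_eq)

text \<open>Taking the coefficient at exponent 0 is multiplicative on O but not on the whole Hahn
  field.\<close>

lemma hahn_red_poly_mult:
  assumes "p \<in> hahn_nonneg_polys" "q \<in> hahn_nonneg_polys"
  shows "hahn_red_poly (p * q) = hahn_red_poly p * hahn_red_poly q"
proof (rule poly_eqI)
  fix i
  have "hahn_nth (x * y) 0 = hahn_nth x 0 * hahn_nth y 0" if "x \<in> hahn_ge 0" "y \<in> hahn_ge 0" for x y :: "'a hahn"
    using hahn_nth_mult_ge[OF that] by simp
  then show "poly.coeff (hahn_red_poly (p * q)) i = poly.coeff (hahn_red_poly p * hahn_red_poly q) i"
    using assms by (simp add: coeff_mult hahn_nth_sum hahn_nonneg_polys_iff)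
qed

lemma hahn_red_poly_pCons [simp]: "hahn_red_poly (pCons a p) = pCons (hahn_nth a 0) (hahn_red_poly p)"
  by (rule poly_eqI) (simp add: coeff_pCons split: nat.splits)

lemma hahn_red_poly_add [simp]: "hahn_red_poly (p + q) = hahn_red_poly p + hahn_red_poly q"
  by (rule poly_eqI) (simp add: plus_hahn.rep_eq)

lemma hahn_red_poly_0 [simp]: "hahn_red_poly 0 = 0"
  by (rule poly_eqI) (simp add: zero_hahn.rep_eq)

lemma hahn_nonneg_polys_pcompose:
  assumes q: "q \<in> hahn_nonneg_polys"
  shows "p \<in> hahn_nonneg_polys \<Longrightarrow> p \<circ>\<^sub>p q \<in> hahn_nonneg_polys"
proof (induction p)
  case (pCons a p)
  then show ?case
    by (simp add: pcompose_pCons hahn_nonneg_polys_pCons hahn_nonneg_polys_add hahn_nonneg_polys_mult q)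
qed simp

lemma hahn_red_poly_pcompose:
  assumes q: "q \<in> hahn_nonneg_polys"
  shows "p \<in> hahn_nonneg_polys \<Longrightarrow> hahn_red_poly (p \<circ>\<^sub>p q) = hahn_red_poly p \<circ>\<^sub>p hahn_red_poly q"
proof (induction p)
  case (pCons a p)
  then show ?case
    by (simp add: pcompose_pCons hahn_nonneg_polys_pCons hahn_red_poly_mult
        hahn_nonneg_polys_pcompose q del: pCons_eq_0_iff)
qed simp

section \<open>Newton polygon of a polynomial at a point\<close>

text \<open>
  The polynomial \<open>p(a + t\<^sup>s u) / t\<^sup>v\<close> in \<open>u\<close>. Below, \<open>v\<close> is the order of \<open>p(a)\<close> and \<open>s\<close> the largest
  slope of the Newton polygon of \<open>p\<close> at \<open>a\<close>, so that \<open>s\<close> is the largest order of \<open>a - b\<close>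
  for a root \<open>b\<close>.
\<close>

definition newton_poly :: "'a::comm_ring_1 hahn poly \<Rightarrow> 'a hahn \<Rightarrow> rat \<Rightarrow> rat \<Rightarrow> 'a hahn poly"
  where "newton_poly p a s v = Polynomial.smult (hahn_power (- v)) (p \<circ>\<^sub>p [:a, hahn_power s:])"

text \<open>With c_i the coefficients of p(a + X), this says that c_0 has order exactly
  \<open>v\<close>, that every c_i has order at least v - i s, and that equality occurs for some i >
  0.\<close>

definition newton_slope :: "'a::comm_ring_1 hahn poly \<Rightarrow> 'a hahn \<Rightarrow> rat \<Rightarrow> rat \<Rightarrow> bool"
  where "newton_slope p a s v \<longleftrightarrow> newton_poly p a s v \<in> hahn_nonneg_polys \<and>
    poly.coeff (hahn_red_poly (newton_poly p a s v)) 0 \<noteq> 0 \<and>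
    Polynomial.degree (hahn_red_poly (newton_poly p a s v)) > 0"

lemma newton_poly_shift:
  "newton_poly p (a + hahn_power s * b) s v = newton_poly p a s v \<circ>\<^sub>p [:b, 1:]"
proof -
  have "[:a + hahn_power s * b, hahn_power s:] = [:a, hahn_power s:] \<circ>\<^sub>p [:b, 1:]"
    by (simp add: pcompose_pCons)
  then show ?thesis by (simp add: newton_poly_def pcompose_smult pcompose_assoc)
qed

lemma coeff_newton_poly_rescale:
  "poly.coeff (newton_poly p a s' v') i =
    hahn_power (v - v' + of_nat i * (s' - s)) * poly.coeff (newton_poly p a s v) i"
proof -
  have "[:a, hahn_power s':] = [:a, hahn_power s:] \<circ>\<^sub>p [:0, hahn_power (s' - s):]"
    by (simp add: pcompose_pCons)
  then have "newton_poly p a s' v' = Polynomial.smult (hahn_power (v - v'))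
      (newton_poly p a s v \<circ>\<^sub>p [:0, hahn_power (s' - s):])"
    by (simp add: newton_poly_def pcompose_smult pcompose_assoc)
  then show ?thesis by (simp add: coeff_pcompose_linear hahn_power_power)
qed

text \<open>With w_i the order of c_i, the candidate slopes are (v - w_i) / i for nonzero c_i with i
  > 0. The maximum works, and an index attaining it gives the reduction positive degree.\<close>

lemma newton_slope_exists:
  fixes p :: "'a::comm_ring_1 hahn poly"
  assumes deg: "Polynomial.degree p > 0" and a: "poly p a \<noteq> 0"
  obtains s v where "newton_slope p a s v"
proof -
  define c where "c i = poly.coeff (p \<circ>\<^sub>p [:a, 1:]) i" for i
  have "c 0 \<noteq> 0" using a by (simp add: c_def)
  then obtain v where v: "c 0 \<in> hahn_ge v" "hahn_nth (c 0) v \<noteq> 0" by (rule hahn_nonzero_order)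
  have "\<exists>w. c i \<noteq> 0 \<longrightarrow> c i \<in> hahn_ge w \<and> hahn_nth (c i) w \<noteq> 0" for i
    by (metis hahn_nonzero_order)
  then obtain w where w: "\<And>i. c i \<noteq> 0 \<Longrightarrow> c i \<in> hahn_ge (w i) \<and> hahn_nth (c i) (w i) \<noteq> 0" by metis
  define I where "I = {i. i > 0 \<and> c i \<noteq> 0}"
  have fin: "finite I"
    by (rule finite_subset[of _ "{..Polynomial.degree (p \<circ>\<^sub>p [:a, 1:])}"])
      (auto simp: I_def c_def intro: le_degree)
  have "I \<noteq> {}"
  proof
    assume "I = {}"
    then have "Polynomial.degree (p \<circ>\<^sub>p [:a, 1:]) = 0"
      by (metis (mono_tags, lifting) I_def c_def empty_iff mem_Collect_eq leading_coeff_0_iff degree_0 gr0I)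
    then obtain d where d: "p \<circ>\<^sub>p [:a, 1:] = [:d:]" by (rule degree_eq_zeroE)
    have "p = p \<circ>\<^sub>p ([:a, 1:] \<circ>\<^sub>p [:- a, 1:])" by (simp add: pcompose_pCons)
    also have "\<dots> = [:d:]" unfolding pcompose_assoc d by simp
    finally show False using deg by simp
  qed
  define s where "s = Max ((\<lambda>i. (v - w i) / of_nat i) ` I)"
  have "s \<in> (\<lambda>i. (v - w i) / of_nat i) ` I"
    unfolding s_def using fin \<open>I \<noteq> {}\<close> by (intro Max_in) auto
  then obtain j where j: "j \<in> I" "s = (v - w j) / of_nat j" by blast
  have s: "(v - w i) / of_nat i \<le> s" if "i \<in> I" for i
    unfolding s_def using fin that by (intro Max_ge) auto
  have co: "poly.coeff (newton_poly p a s v) i = hahn_power (of_nat i * s - v) * c i" for i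
    using coeff_newton_poly_rescale[of p a s v i 0 0] by (simp add: newton_poly_def c_def)
  have "c i \<in> hahn_ge (v - of_nat i * s)" for i
  proof (cases "c i = 0")
    case False
    show ?thesis
    proof (cases "i = 0")
      case True
      then show ?thesis using v by simp
    next
      case i: False
      then have "v - of_nat i * s \<le> w i" using s[of i] False by (simp add: I_def field_simps)
      then show ?thesis using w[OF False] hahn_ge_mono by blast
    qed
  qed simp
  moreover have "hahn_nth (c j) (v - of_nat j * s) \<noteq> 0"
    using j w[of j] by (simp add: I_def)
  then have "j \<le> Polynomial.degree (hahn_red_poly (newton_poly p a s v))"
    by (intro le_degree) (simp add: co)
  moreover have "j > 0" using j by (simp add: I_def)
  ultimately have "newton_slope p a s v"
    using v(2) by (auto simp: newton_slope_def hahn_nonneg_polys_iff co)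
  then show ?thesis by (rule that)
qed

text \<open>Recentring at \<open>b\<close> only translates the reduced polynomial, so some
  coefficient with i > 0 keeps order 0. Comparing with the scale given by \<open>s'\<close> and
  \<open>v'\<close> yields v' - v <= i (s' - s), while v <= v'. If the reduction vanishes at the
  residue of (b - a) / t^s, then v < v' and the slope grows strictly.\<close>

lemma newton_slope_mono:
  fixes p :: "'a::idom hahn poly"
  assumes as: "newton_slope p a s v" and b: "b - a \<in> hahn_ge s" and bs: "newton_slope p b s' v'"
  shows "s \<le> s'"
    and "poly (hahn_red_poly (newton_poly p a s v)) (hahn_nth (b - a) s) = 0 \<Longrightarrow> s < s'"
proof -
  define \<beta> where "\<beta> = hahn_power (- s) * (b - a)"
  have \<beta>: "\<beta> \<in> hahn_ge 0" "b = a + hahn_power s * \<beta>" "hahn_nth \<beta> 0 = hahn_nth (b - a) s"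
    using b by (simp_all add: \<beta>_def)
  define q where "q = newton_poly p b s v"
  have lin: "[:\<beta>, 1:] \<in> hahn_nonneg_polys" using \<beta>(1) by (simp add: hahn_nonneg_polys_pCons)
  have q: "q = newton_poly p a s v \<circ>\<^sub>p [:\<beta>, 1:]" by (simp add: q_def \<beta>(2) newton_poly_shift)
  have q_nonneg: "q \<in> hahn_nonneg_polys"
    using as unfolding q by (intro hahn_nonneg_polys_pcompose lin) (simp add: newton_slope_def)
  have red_q: "hahn_red_poly q = hahn_red_poly (newton_poly p a s v) \<circ>\<^sub>p [:hahn_nth \<beta> 0, 1:]"
    using as unfolding q
    by (subst hahn_red_poly_pcompose[OF lin]) (simp_all add: newton_slope_def one_hahn.rep_eq)
  have "Polynomial.degree (hahn_red_poly q) > 0"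
    using as by (simp add: red_q degree_pcompose newton_slope_def)
  then obtain i where i: "i > 0" "poly.coeff (hahn_red_poly q) i \<noteq> 0"
    by (metis leading_coeff_0_iff degree_0 less_irrefl)
  have co: "hahn_nth (poly.coeff (newton_poly p b s' v') i) r =
      hahn_nth (poly.coeff q i) (r - (v - v' + of_nat i * (s' - s)))" for i r
    unfolding q_def by (subst coeff_newton_poly_rescale[of p b s' v' i v s]) simp
  have ge: "r \<ge> 0" if "hahn_nth (poly.coeff (newton_poly p b s' v') i) r \<noteq> 0" for i r
    using bs that hahn_ge_nth by (force simp: newton_slope_def hahn_nonneg_polys_iff)
  have geq: "r \<ge> 0" if "hahn_nth (poly.coeff q i) r \<noteq> 0" for i r
    using q_nonneg that hahn_ge_nth by (force simp: hahn_nonneg_polys_iff)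
  have "hahn_nth (poly.coeff (newton_poly p b s' v') 0) 0 \<noteq> 0"
    using bs by (simp add: newton_slope_def)
  then have nz: "hahn_nth (poly.coeff q 0) (v' - v) \<noteq> 0" by (simp add: co)
  then have v: "v \<le> v'" using geq by fastforce
  have "v - v' + of_nat i * (s' - s) \<ge> 0"
    by (rule ge[of i]) (use i(2) in \<open>simp add: co\<close>)
  then have *: "v' - v \<le> of_nat i * (s' - s)" by simp
  with v have "0 \<le> of_nat i * (s' - s)" by simp
  with i(1) show "s \<le> s'" by (simp add: zero_le_mult_iff)
  assume "poly (hahn_red_poly (newton_poly p a s v)) (hahn_nth (b - a) s) = 0"
  then have "poly.coeff (hahn_red_poly q) 0 = 0" unfolding red_q by (simp add: \<beta>(3))
  with nz have "v \<noteq> v'" by auto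
  with v * have "0 < of_nat i * (s' - s)" by simp
  with i(1) show "s < s'" by (simp add: zero_less_mult_iff)
qed

theorem hahn_poly_has_root:
  fixes p :: "'k::alg_closed_field hahn poly"
  assumes deg: "Polynomial.degree p > 0"
  shows "\<exists>a. poly p a = 0"
proof (rule ccontr)
  assume "\<not> ?thesis"
  then have slope: "\<exists>s v. newton_slope p a s v" for a
    using newton_slope_exists[OF deg] by metis
  define S where "S = {(a, s). \<exists>v. newton_slope p a s v}"
  \<comment> \<open>Going up in \<open>less\<close> shrinks the ball a + t^s O. The strict
    inequality makes \<open>less\<close> irreflexive, which later puts \<open>(b, r)\<close> outside
    \<open>C\<close>.\<close>
  define less where "less = (\<lambda>(a :: 'k hahn, s) (b, r). s < r \<and> b - a \<in> hahn_ge s)"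
  obtain C where C: "pred_on.maxchain S less C"
    using pred_on.Hausdorff[of S less] by blast
  then have chain: "pred_on.chain S less C" by (rule pred_on.maxchain_imp_chain)
  have nested: "b - a \<in> hahn_ge s" if "(a, s) \<in> C" "(b, r) \<in> C" "s \<le> r" for a s b r
    using pred_on.chain_total[OF chain that(1,2)] that(3) by (auto simp: less_def)
  obtain \<alpha> where \<alpha>: "\<And>a s. (a, s) \<in> C \<Longrightarrow> \<alpha> - a \<in> hahn_ge s"
    by (rule hahn_spherically_complete[of C]) (auto intro: nested)
  obtain s v where s: "newton_slope p \<alpha> s v" using slope by blast
  then obtain z where z: "poly (hahn_red_poly (newton_poly p \<alpha> s v)) z = 0"
    using alg_closed_imp_poly_has_root by (auto simp: newton_slope_def)
  \<comment> \<open>The Newton step: the root \<open>z\<close> of the reduced polynomial cancels the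
    leading term of p(\<alpha>), so the slope at \<open>b\<close> exceeds \<open>s\<close>.\<close>
  define b where "b = \<alpha> + hahn_power s * hahn_const z"
  have b: "b - \<alpha> \<in> hahn_ge s" "hahn_nth (b - \<alpha>) s = z"
    by (simp_all add: b_def hahn_const.rep_eq)
  obtain r w where r: "newton_slope p b r w" using slope by blast
  have sr: "s < r" using newton_slope_mono(2)[OF s b(1) r] z b(2) by simp
  \<comment> \<open>Slopes in the chain are at most \<open>s\<close>, since \<alpha> lies in all its
    balls. Hence \<open>(b, r)\<close> would extend the maximal chain.\<close>
  have above: "less x (b, r)" if "x \<in> C" for x
  proof -
    obtain a s0 where x: "x = (a, s0)" by (cases x)
    have "x \<in> S" using chain that by (auto simp: pred_on.chain_def)
    then have "s0 \<le> s" using newton_slope_mono(1)[OF _ \<alpha> s] that x by (auto simp: S_def)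
    moreover have "(b - \<alpha>) + (\<alpha> - a) \<in> hahn_ge s0"
      using that x by (intro hahn_ge_add hahn_ge_mono[OF b(1) \<open>s0 \<le> s\<close>] \<alpha>) simp
    then have "b - a \<in> hahn_ge s0" by simp
    ultimately show ?thesis using sr by (simp add: less_def x)
  qed
  have "(b, r) \<notin> C" using above by (fastforce simp: less_def)
  moreover have "pred_on.chain S less (insert (b, r) C)"
    using chain above r by (auto simp: pred_on.chain_def S_def)
  ultimately show False using C unfolding pred_on.maxchain_def by blast
qed


section \<open>Maximal subrings\<close>

text \<open>Here 1/t = F(x) = G(y). Multiplying the second relation by x^n, with n the degree of
  \<open>F\<close>, expresses (1 - t b_0) x^n through lower powers of x with coefficients in
  \<open>A\<close>, because x y lies in \<open>A\<close> and \<open>G\<close> has degree at most n.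
  This eliminates the leading term of \<open>F\<close>.\<close>

lemma chevalley_step:
  fixes t x y :: "'a::comm_ring_1"
  assumes A: "is_subring A" and t: "t \<in> A" and xy: "x * y \<in> A"
    and no_inv: "\<And>a. a \<in> A \<Longrightarrow> t * a \<noteq> 1"
    and F: "\<And>i. poly.coeff F i \<in> A" "t * poly F x = 1"
    and G: "\<And>i. poly.coeff G i \<in> A" "t * poly G y = 1"
    and le: "Polynomial.degree G \<le> Polynomial.degree F"
  obtains H where "\<And>i. poly.coeff H i \<in> A" "t * poly H x = 1"
    "Polynomial.degree H < Polynomial.degree F"
proof -
  define n m where "n = Polynomial.degree F" and "m = Polynomial.degree G"
  define a b where "a = poly.coeff F" and "b = poly.coeff G"
  note A' = is_subringD[OF A]
  have ab: "a i \<in> A" "b i \<in> A" for i using F G by (auto simp: a_def b_def)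
  \<comment> \<open>A constant \<open>F\<close> would invert \<open>t\<close> inside
    \<open>A\<close>.\<close>
  have "n \<noteq> 0"
  proof
    assume "n = 0"
    then have "poly F x = a 0" by (simp add: poly_altdef n_def a_def)
    then show False using no_inv[OF ab(1)[of 0]] F(2) by simp
  qed
  define L where "L = F - Polynomial.monom (a n) n"
  define E where "E = (\<Sum>j=1..m. Polynomial.monom (b j * (x * y) ^ j) (n - j))"
  \<comment> \<open>Since 1 - t b_0 need not be invertible in \<open>A\<close>, the relation for
    \<open>F\<close> is multiplied by it; the summand b_0 restores the value, as t b_0 + (1 - t b_0)
    = 1.\<close>
  define H where "H = [:b 0:] + Polynomial.smult (1 - t * b 0) L + Polynomial.smult (a n * t) E"
  have L: "poly.coeff L i = (if i = n then 0 else a i)" for i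
    by (auto simp: L_def a_def)
  have E_A: "poly.coeff E i \<in> A" for i
    unfolding E_def coeff_sum coeff_monom
    by (intro is_subring_sum[OF A]) (auto intro: A' ab xy)
  have E_0: "poly.coeff E i = 0" if "i \<ge> n" for i
    unfolding E_def coeff_sum coeff_monom
    using that \<open>n \<noteq> 0\<close> by (intro sum.neutral) auto
  have "poly.coeff [:b 0:] i \<in> A" for i by (cases i) (auto simp: ab A')
  then have 1: "poly.coeff H i \<in> A" for i
    by (auto simp: H_def L intro!: A'(4-6) A'(1,2) t ab E_A)
  have "poly.coeff H i = 0" if "i \<ge> n" for i
  proof -
    have "poly.coeff F i = 0" if "i > n" using that by (simp add: n_def coeff_eq_0)
    moreover have "poly.coeff [:b 0:] i = 0" using that \<open>n \<noteq> 0\<close> by (cases i) auto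
    ultimately show ?thesis using that by (auto simp: H_def L E_0 a_def)
  qed
  then have 2: "Polynomial.degree H < n" using \<open>n \<noteq> 0\<close> by (intro degree_lessI) auto
  have "poly G y = (\<Sum>j\<in>insert 0 {1..m}. b j * y ^ j)"
    unfolding poly_altdef b_def m_def by (rule sum.cong) auto
  also have "\<dots> = b 0 + (\<Sum>j=1..m. b j * y ^ j)" by simp
  finally have G': "t * (\<Sum>j=1..m. b j * y ^ j) = 1 - t * b 0"
    using G(2) by (simp add: algebra_simps)
  have "poly E x = (\<Sum>j=1..m. b j * y ^ j * x ^ n)"
    unfolding E_def poly_sum poly_monom
  proof (rule sum.cong)
    fix j assume "j \<in> {1..m}"
    then have "x ^ n = x ^ j * x ^ (n - j)" using le by (simp add: n_def m_def flip: power_add)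
    then show "b j * (x * y) ^ j * x ^ (n - j) = b j * y ^ j * x ^ n"
      by (simp add: power_mult_distrib mult_ac)
  qed simp
  then have E: "t * poly E x = (1 - t * b 0) * x ^ n"
    using G' by (simp flip: sum_distrib_right mult.assoc)
  have "t * poly H x = t * b 0 + (1 - t * b 0) * (t * poly F x) - (1 - t * b 0) * t * a n * x ^ n
      + a n * t * (t * poly E x)"
    by (simp add: H_def L_def poly_monom algebra_simps)
  also have "\<dots> = 1" unfolding E F(2) by (simp add: algebra_simps)
  finally show ?thesis using that[of H] 1 2 by (simp add: n_def)
qed

text \<open>The two relations play symmetric roles, so the one of larger degree can always be
  lowered, and the sum of the degrees cannot descend forever.\<close>

lemma chevalley_contradiction:
  fixes t x y :: "'a::comm_ring_1"
  assumes A: "is_subring A" and t: "t \<in> A" and xy: "x * y \<in> A"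
    and no_inv: "\<And>a. a \<in> A \<Longrightarrow> t * a \<noteq> 1"
    and F: "\<And>i. poly.coeff F i \<in> A" "t * poly F x = 1"
    and G: "\<And>i. poly.coeff G i \<in> A" "t * poly G y = 1"
  shows False
  using F G
proof (induction "Polynomial.degree F + Polynomial.degree G" arbitrary: F G rule: less_induct)
  case less
  show False
  proof (cases "Polynomial.degree G \<le> Polynomial.degree F")
    case True
    obtain H where "\<And>i. poly.coeff H i \<in> A" "t * poly H x = 1"
      "Polynomial.degree H < Polynomial.degree F"
      using chevalley_step[OF A t xy no_inv less.prems True] by blast
    then show False using less.hyps[of H G] less.prems by auto
  next
    case False
    have yx: "y * x \<in> A" using xy by (simp add: mult.commute)
    obtain H where "\<And>i. poly.coeff H i \<in> A" "t * poly H y = 1"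
      "Polynomial.degree H < Polynomial.degree G"
      using chevalley_step[OF A t yx no_inv less.prems(3,4,1,2)] False by auto
    then show False using less.hyps[of F H] less.prems by auto
  qed
qed

section \<open>Maximal subrings and Chevalley's dichotomy\<close>

definition is_maximal_subring :: "'a::comm_ring_1 set \<Rightarrow> bool"
  where "is_maximal_subring A \<longleftrightarrow> is_subring A \<and> A \<noteq> UNIV \<and>
    (\<forall>B. is_subring B \<longrightarrow> A \<subset> B \<longrightarrow> B = UNIV)"

lemma maximal_subring_ring_of_type_algebra_iff:
  "maximal_subring A (ring_of_type_algebra :: 'a::comm_ring_1 ring) \<longleftrightarrow> is_maximal_subring A"
proof -
  have carr: "carrier (ring_of_type_algebra :: 'a ring) = UNIV"
    by (simp add: ring_of_type_algebra_def)
  show ?thesis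
    unfolding maximal_subring_def is_maximal_subring_def subring_ring_of_type_algebra_iff carr by blast
qed

lemma is_maximal_subring_adjoin:
  assumes max: "is_maximal_subring A" and x: "x \<notin> A"
  obtains F where "\<And>i. poly.coeff F i \<in> A" "u = poly F x"
proof -
  have A: "is_subring A" using max by (simp add: is_maximal_subring_def)
  note A' = is_subringD[OF A]
  define B where "B = {poly F x | F. \<forall>i. poly.coeff F i \<in> A}"
  have const: "\<forall>i. poly.coeff [:a:] i \<in> A" if "a \<in> A" for a
    using that by (auto simp: coeff_pCons A' split: nat.splits)
  have "is_subring B"
    unfolding is_subring_def
  proof (intro conjI ballI)
    show "1 \<in> B" using const[OF A'(1)] by (force simp: B_def)
    fix u v assume "u \<in> B" "v \<in> B"
    then obtain F G where *: "u = poly F x" "v = poly G x" "\<And>i. poly.coeff F i \<in> A" "\<And>i. poly.coeff G i \<in> A"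
      by (auto simp: B_def)
    have "u - v = poly (F - G) x" "u * v = poly (F * G) x" using * by auto
    moreover have "\<forall>i. poly.coeff (F - G) i \<in> A" "\<forall>i. poly.coeff (F * G) i \<in> A"
      using * by (auto intro: A' is_subring_coeff_mult[OF A])
    ultimately show "u - v \<in> B" "u * v \<in> B" by (auto simp only: B_def)
  qed
  moreover have "A \<subseteq> B" using const by (force simp: B_def)
  moreover have "\<forall>i. poly.coeff [:0, 1:] i \<in> A" by (auto simp: coeff_pCons A' split: nat.splits)
  then have "x \<in> B" by (force simp: B_def)
  ultimately have "B = UNIV" using max x unfolding is_maximal_subring_def by blast
  then show ?thesis using that by (auto simp: B_def)
qed

text \<open>
  By maximality both \<open>A[x]\<close> and \<open>A[y]\<close> contain \<open>u = 1/t\<close>, so Chevalley's argument for the existence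
  of valuation rings leads to a contradiction.
\<close>

lemma is_maximal_subring_mult:
  assumes max: "is_maximal_subring A" and t: "t \<in> A" "t * u = 1" "u \<notin> A" and xy: "x * y \<in> A"
  shows "x \<in> A \<or> y \<in> A"
proof (rule ccontr)
  assume n: "\<not> ?thesis"
  have A: "is_subring A" using max by (simp add: is_maximal_subring_def)
  have no_inv: "t * a \<noteq> 1" if "a \<in> A" for a
  proof
    assume "t * a = 1"
    have "u = t * a * u" using \<open>t * a = 1\<close> by simp
    also have "\<dots> = t * u * a" by (simp only: mult_ac)
    finally show False using t(2,3) that by simp
  qed
  obtain F where F: "\<And>i. poly.coeff F i \<in> A" "u = poly F x"
    using is_maximal_subring_adjoin[OF max] n by blast
  obtain G where G: "\<And>i. poly.coeff G i \<in> A" "u = poly G y"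
    using is_maximal_subring_adjoin[OF max] n by blast
  show False
    by (rule chevalley_contradiction[OF A t(1) xy no_inv F(1) _ G(1)]) (use t F G in auto)
qed


section \<open>Maximal subrings of the polynomial ring\<close>

lemma is_maximal_subring_hahn_poly:
  fixes A :: "'k::alg_closed_field hahn poly set"
  assumes max: "is_maximal_subring A" and sub: "hahn_nonneg_polys \<subseteq> A"
  obtains \<alpha> where "\<alpha> \<in> hahn_nonneg" "A \<subseteq> {p. poly p \<alpha> \<in> hahn_nonneg}"
proof -
  have A: "is_subring A" and ne: "A \<noteq> UNIV" using max by (auto simp: is_maximal_subring_def)
  note A' = is_subringD[OF A]
  have const: "[:c:] \<in> A" if "c \<in> hahn_ge 0" for c
    using that sub by (auto simp: hahn_nonneg_polys_pCons)
  have X: "[:0, 1:] \<in> A" using sub by (auto simp: hahn_nonneg_polys_pCons)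
  \<comment> \<open>A constant outside O would, by maximality of O, bring all constants into
    \<open>A\<close>; together with y they generate the whole ring.\<close>
  have const_iff: "[:c:] \<in> A \<longleftrightarrow> c \<in> hahn_ge 0" for c
  proof (rule iffI, rule ccontr)
    assume c: "[:c:] \<in> A" "c \<notin> hahn_ge 0"
    define B where "B = {c. [:c:] \<in> A}"
    have "is_subring B"
      unfolding is_subring_def B_def
      using A'(1) A'(4) A'(6) by (fastforce simp: one_pCons)
    moreover have "hahn_nonneg \<subseteq> B" by (auto simp: B_def const hahn_nonneg_eq)
    ultimately have "B = UNIV"
      using hahn_nonneg_maximal[of B c] c by (simp add: B_def hahn_nonneg_eq)
    then have all_const: "[:c:] \<in> A" for c by (auto simp: B_def)
    have "p \<in> A" for p
    proof (induction p)
      case (pCons a p)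
      have "[:a:] + [:0, 1:] * p \<in> A" by (intro A' all_const X pCons)
      then show ?case by simp
    qed (simp add: A')
    with ne show False by blast
  qed (rule const)
  \<comment> \<open>The dichotomy is applied with t, whose inverse is not in \<open>A\<close> by
    \<open>const_iff\<close>.\<close>
  have mult: "x \<in> A \<or> y \<in> A" if "x * y \<in> A" for x y
    by (rule is_maximal_subring_mult[OF max _ _ _ that, of "[:hahn_power 1:]" "[:hahn_power (- 1):]"])
      (simp_all add: const_iff one_pCons)
  have smultA: "Polynomial.smult c p \<in> A" if "c \<in> hahn_ge 0" "p \<in> A" for c p
    using A'(6)[OF const[OF that(1)] that(2)] by simp
  define S where "S = {(a, s). Polynomial.smult (hahn_power (- s)) [:- a, 1:] \<in> A}"
  \<comment> \<open>The combination below cancels y and leaves the constant (b - a) / t^s, which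
    therefore lies in O.\<close>
  have nested: "b - a \<in> hahn_ge s" if "(a, s) \<in> S" "(b, r) \<in> S" "s \<le> r" for a s b r
  proof -
    have "hahn_power (r - s) \<in> hahn_ge 0" using that(3) by simp
    then have "Polynomial.smult (hahn_power (- s)) [:- a, 1:]
        - Polynomial.smult (hahn_power (r - s)) (Polynomial.smult (hahn_power (- r)) [:- b, 1:]) \<in> A"
      using that(1,2) unfolding S_def by (blast intro: A'(4) smultA)
    also have "Polynomial.smult (hahn_power (- s)) [:- a, 1:]
        - Polynomial.smult (hahn_power (r - s)) (Polynomial.smult (hahn_power (- r)) [:- b, 1:])
        = [:hahn_power (- s) * (b - a):]"
      by (simp add: algebra_simps)
    finally show ?thesis by (simp add: const_iff)
  qed
  obtain \<alpha> where \<alpha>: "\<And>a s. (a, s) \<in> S \<Longrightarrow> \<alpha> - a \<in> hahn_ge s"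
    by (rule hahn_spherically_complete[of S]) (auto intro: nested)
  \<comment> \<open>The scale \<open>s\<close> is kept free because splitting off a linear factor
    redistributes powers of t; in the end it is set to 0.\<close>
  have "poly p \<alpha> \<in> hahn_ge (- s)" if "Polynomial.smult (hahn_power s) p \<in> A" for p s
    using that
  proof (induction "Polynomial.degree p" arbitrary: p s)
    case 0
    then obtain c where "p = [:c:]" by (metis degree_eq_zeroE)
    with 0 show ?case by (simp add: const_iff)
  next
    case (Suc n)
    then obtain a where a: "poly p a = 0" using hahn_poly_has_root[of p] by auto
    define q where "q = synthetic_div p a"
    have p: "p = [:- a, 1:] * q" using synthetic_div_correct'[of a p] a by (simp add: q_def)
    have deg: "n = Polynomial.degree q" using Suc.hyps(2) by (simp add: q_def degree_synthetic_div)
    show ?case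
    proof (cases "\<alpha> = a")
      case True
      then show ?thesis using a by simp
    next
      case False
      then obtain w where w: "\<alpha> - a \<in> hahn_ge w" "hahn_nth (\<alpha> - a) w \<noteq> 0"
        using hahn_nonzero_order[of "\<alpha> - a"] by auto
      \<comment> \<open>For \<open>r\<close> above the order of \<alpha> - a, the ball a + t^r O
        misses \<alpha>, so (y - a) / t^r is not in \<open>A\<close> and the complementary factor
        must be.\<close>
      have q: "poly q \<alpha> \<in> hahn_ge (- (s + r))" if "w < r" for r
      proof (rule Suc.hyps(1)[OF deg])
        have "\<alpha> - a \<notin> hahn_ge r" using w(2) that hahn_ge_nth by blast
        then have "(a, r) \<notin> S" using \<alpha> by blast
        then have "Polynomial.smult (hahn_power (- r)) [:- a, 1:] \<notin> A" by (simp add: S_def)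
        moreover have "Polynomial.smult (hahn_power (- r)) [:- a, 1:] * Polynomial.smult (hahn_power (s + r)) q \<in> A"
          using Suc.prems unfolding p by (simp only: mult_smult_left mult_smult_right smult_smult) simp
        ultimately show "Polynomial.smult (hahn_power (s + r)) q \<in> A" using mult by blast
      qed
      \<comment> \<open>The value \<open>r = w\<close> is not covered above, since \<alpha> does lie
        in a + t^w O; density of the exponents gives it as a limit.\<close>
      have "poly q \<alpha> \<in> hahn_ge (- (s + w))"
      proof -
        have "hahn_nth (poly q \<alpha>) e = 0" if "e < - (s + w)" for e
        proof -
          have "w < - s - e" using that by simp
          then obtain r where r: "w < r" "r < - s - e" using dense by blast
          then show ?thesis using hahn_ge_nth[OF q[OF r(1)], of e] by simp
        qed
        then show ?thesis by (simp add: hahn_ge_def)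
      qed
      then have "(\<alpha> - a) * poly q \<alpha> \<in> hahn_ge (w + - (s + w))" by (rule hahn_ge_mult[OF w(1)])
      then show ?thesis by (simp add: p algebra_simps)
    qed
  qed
  from this[of 0] have "poly p \<alpha> \<in> hahn_nonneg" if "p \<in> A" for p
    using that by (simp add: hahn_nonneg_eq)
  \<comment> \<open>As y lies in \<open>A\<close>, its value \<alpha> lies in O.\<close>
  then show ?thesis using that[of \<alpha>] X by fastforce
qed

section \<open>Subrings cut out by the value at a point\<close>

lemma is_subring_hahn_poly_eval: "is_subring {p. poly p \<alpha> \<in> (hahn_nonneg :: 'a::comm_ring_1 hahn set)}"
  using is_subring_hahn_nonneg by (auto simp: is_subring_def)

text \<open>Modulo multiples of y - \<alpha>, all of which belong to the set, a polynomial equals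
  its value at \<alpha>. So the claim reduces to the maximality of O in K.\<close>

lemma is_maximal_subring_hahn_poly_eval:
  fixes \<alpha> :: "'a::field hahn"
  shows "is_maximal_subring {p. poly p \<alpha> \<in> hahn_nonneg}" (is "is_maximal_subring ?A")
  unfolding is_maximal_subring_def
proof (intro conjI allI impI)
  show "is_subring ?A" by (rule is_subring_hahn_poly_eval)
  have "[:hahn_power (- 1):] \<notin> ?A" by (simp add: hahn_nonneg_eq)
  then show "?A \<noteq> UNIV" by blast
  fix B assume B: "is_subring B" and AB: "?A \<subset> B"
  note B' = is_subringD[OF B]
  from AB obtain f where f: "f \<in> B" "poly f \<alpha> \<notin> hahn_nonneg" by blast
  define C where "C = {c. [:c:] \<in> B}"
  have "is_subring C"
    unfolding is_subring_def C_def using B'(1) B'(4) B'(6) by (fastforce simp: one_pCons)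
  moreover have "hahn_nonneg \<subseteq> C" using AB by (auto simp: C_def)
  moreover have vanish: "[:- \<alpha>, 1:] * q \<in> B" for q
  proof -
    have "[:- \<alpha>, 1:] * q \<in> ?A" by (simp add: hahn_nonneg_eq)
    then show ?thesis using AB by blast
  qed
  have "[:poly f \<alpha>:] = f - [:- \<alpha>, 1:] * synthetic_div f \<alpha>"
    using synthetic_div_correct'[of \<alpha> f] by (metis add_diff_cancel_left')
  then have "poly f \<alpha> \<in> C" using B'(4)[OF f(1) vanish] by (simp add: C_def)
  ultimately have "C = UNIV" using hahn_nonneg_maximal f(2) by blast
  then have "[:c:] \<in> B" for c by (auto simp: C_def)
  then have "p \<in> B" for p
    using B'(5)[OF vanish, of "[:poly p \<alpha>:]" "synthetic_div p \<alpha>"] synthetic_div_correct'[of \<alpha> p] by simp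
  then show "B = UNIV" by blast
qed

lemma extending_hahn_poly_eval:
  fixes \<alpha> :: "'a::field hahn"
  shows "extending {p. poly p \<alpha> \<in> hahn_nonneg} hahn_poly_ring" (is "extending ?A ?R")
proof -
  interpret R: cring ?R ..
  have carr: "carrier ?R = UNIV"
    and ops: "x \<oplus>\<^bsub>?R\<^esub> y = x + y" "x \<otimes>\<^bsub>?R\<^esub> y = x * y" "\<zero>\<^bsub>?R\<^esub> = 0" "\<one>\<^bsub>?R\<^esub> = 1"
    for x y :: "'a hahn poly"
    by (simp_all add: ring_of_type_algebra_def)
  have "subcring ?A ?R"
    using is_subring_hahn_poly_eval by (intro R.subcringI') (simp add: subring_ring_of_type_algebra_iff)
  then have "cring (?R\<lparr>carrier := ?A\<rparr>)"
    using R.subcring_iff[of ?A] by (simp add: carr)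
  then interpret A: cring "?R\<lparr>carrier := ?A\<rparr>" .
  \<comment> \<open>The preimage of the maximal ideal of O under evaluation at \<alpha>.\<close>
  define M where "M = {p \<in> ?A. hahn_nth (poly p \<alpha>) 0 = 0}"
  have nth_mult: "hahn_nth (x * y) 0 = hahn_nth x 0 * hahn_nth y 0"
    if "x \<in> hahn_nonneg" "y \<in> hahn_nonneg" for x y :: "'a hahn"
    using hahn_nth_mult_ge[of x 0 y 0] that by (simp add: hahn_nonneg_eq)
  have mult: "x * y \<in> hahn_nonneg" if "x \<in> hahn_nonneg" "y \<in> hahn_nonneg" for x y :: "'a hahn"
    using is_subringD(6)[OF is_subring_hahn_nonneg] that by blast
  have inv: "\<ominus>\<^bsub>?R\<lparr>carrier := ?A\<rparr>\<^esub> x = - x" if "x \<in> ?A" for x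
    by (rule A.minus_equality) (use that in \<open>simp_all add: ops hahn_nonneg_eq hahn_ge_uminus\<close>)
  have "subgroup M (add_monoid (?R\<lparr>carrier := ?A\<rparr>))"
  proof (rule A.add.subgroupI)
    have "0 \<in> M" by (simp add: M_def hahn_nonneg_eq zero_hahn.rep_eq)
    then show "M \<noteq> {}" by blast
  next
    fix a assume "a \<in> M"
    then have "a \<in> ?A" by (simp add: M_def)
    then have "\<ominus>\<^bsub>?R\<lparr>carrier := ?A\<rparr>\<^esub> a = - a" by (rule inv)
    with \<open>a \<in> M\<close> show "\<ominus>\<^bsub>?R\<lparr>carrier := ?A\<rparr>\<^esub> a \<in> M"
      by (simp add: M_def hahn_nonneg_eq hahn_ge_uminus uminus_hahn.rep_eq)
  qed (auto simp: M_def ops hahn_nonneg_eq hahn_ge_add plus_hahn.rep_eq)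
  then have "ideal M (?R\<lparr>carrier := ?A\<rparr>)"
    by (intro idealI A.ring_axioms) (auto simp: M_def ops mult nth_mult)
  then have "primeideal M (?R\<lparr>carrier := ?A\<rparr>)"
  proof (rule primeidealI)
    have "1 \<in> ?A" "1 \<notin> M" by (simp_all add: M_def hahn_nonneg_eq one_hahn.rep_eq)
    then show "carrier (?R\<lparr>carrier := ?A\<rparr>) \<noteq> M" by auto
  qed (auto simp: M_def ops mult nth_mult A.cring_axioms)
  then have "M \<in> Spec (?R\<lparr>carrier := ?A\<rparr>)" by (simp add: Spec_def)
  moreover have "M \<noteq> P \<inter> ?A" if "P \<in> Spec ?R" for P
  proof
    assume M: "M = P \<inter> ?A"
    interpret P: primeideal P ?R using that by (simp add: Spec_def)
    have "[:hahn_power 1:] \<in> M" by (simp add: M_def hahn_nonneg_eq hahn_power.rep_eq)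
    then have "[:hahn_power 1:] \<in> P" using M by blast
    then have "[:hahn_power 1:] * [:hahn_power (- 1):] \<in> P"
      using P.I_r_closed[of "[:hahn_power 1:]" "[:hahn_power (- 1):]"] by (simp only: carr ops UNIV_I)
    then have "1 \<in> P" by (simp add: one_pCons)
    then have "P = carrier ?R" using P.one_imp_carrier by (simp add: ops)
    then show False using P.I_notcarr by simp
  qed
  ultimately show ?thesis by (auto simp: extending_def)
qed

lemma subalgebra_hahn_poly_eval:
  "subalgebra hahn_poly_consts {p. poly p \<alpha> \<in> (hahn_nonneg :: 'a::comm_ring_1 hahn set)} hahn_poly_ring"
proof -
  have "subring {p. poly p \<alpha> \<in> (hahn_nonneg :: 'a hahn set)} hahn_poly_ring"
    unfolding subring_ring_of_type_algebra_iff by (rule is_subring_hahn_poly_eval)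
  moreover have "hahn_const c * x \<in> hahn_nonneg" if "x \<in> hahn_nonneg" for c and x :: "'a hahn"
    using hahn_ge_mult[of "hahn_const c" 0 x 0] that by (simp add: hahn_nonneg_eq)
  ultimately show ?thesis
    by (auto simp: subalgebra_def subring_def subalgebra_axioms_def hahn_poly_consts_def
        ring_of_type_algebra_def)
qed

text \<open>Division by y - \<alpha> leaves the remainder p(\<alpha>).\<close>

lemma hahn_poly_eval_set_eq:
  "{[:c:] + [:- \<alpha>, 1:] * q | c q. c \<in> hahn_nonneg} = {p. poly p \<alpha> \<in> (hahn_nonneg :: 'a::comm_ring_1 hahn set)}"
proof (intro equalityI subsetI)
  fix p assume "p \<in> {p. poly p \<alpha> \<in> (hahn_nonneg :: 'a hahn set)}"
  then show "p \<in> {[:c:] + [:- \<alpha>, 1:] * q | c q. c \<in> hahn_nonneg}"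
    using synthetic_div_correct'[of \<alpha> p]
    by (intro CollectI exI[of _ "poly p \<alpha>"] exI[of _ "synthetic_div p \<alpha>"]) (simp add: add.commute)
qed auto

lemma hahn_poly_eval_inj:
  fixes \<alpha> \<beta> :: "'a::comm_ring_1 hahn"
  assumes "{p. poly p \<alpha> \<in> hahn_nonneg} = {p. poly p \<beta> \<in> hahn_nonneg}"
  shows "\<alpha> = \<beta>"
proof (rule hahn_eqI)
  fix s
  \<comment> \<open>The value of (y - \<alpha>) / t^(s+1) at \<beta> lies in O only if \<alpha> and
    \<beta> agree at all exponents below s + 1, in particular at \<open>s\<close>.\<close>
  have "Polynomial.smult (hahn_power (- (s + 1))) [:- \<alpha>, 1:] \<in> {p. poly p \<alpha> \<in> hahn_nonneg}"
    by (simp add: hahn_nonneg_eq)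
  then have "hahn_power (- (s + 1)) * (\<beta> - \<alpha>) \<in> hahn_ge 0"
    unfolding assms by (simp add: hahn_nonneg_eq algebra_simps)
  then have "hahn_nth (\<beta> - \<alpha>) s = 0"
    unfolding hahn_power_mult_ge_iff by (rule hahn_ge_nth) simp
  then show "hahn_nth \<alpha> s = hahn_nth \<beta> s" by (simp add: minus_hahn.rep_eq)
qed

lemma hahn_poly_eval_nonneg_polys:
  assumes "\<alpha> \<in> hahn_nonneg"
  shows "hahn_nonneg_polys \<subseteq> {p. poly p \<alpha> \<in> (hahn_nonneg :: 'a::comm_ring_1 hahn set)}"
  using assms
  by (auto simp: hahn_nonneg_polys_def poly_altdef
      intro!: is_subring_sum[OF is_subring_hahn_nonneg] is_subringD(6,7)[OF is_subring_hahn_nonneg])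

theorem theorem1p0p3:
  shows "bij_betw
    (\<lambda>\<alpha> :: 'k::alg_closed_field hahn. {[:c:] + [:- \<alpha>, 1:] * q | c q. c \<in> hahn_nonneg})
    hahn_nonneg
    {A. maximal_subalgebra hahn_poly_consts A hahn_poly_ring
      \<and> extending A hahn_poly_ring \<and> hahn_nonneg_polys \<subseteq> A}"
  unfolding hahn_poly_eval_set_eq bij_betw_def
proof (intro conjI equalityI subsetI; (elim imageE CollectE conjE)?)
  show "inj_on (\<lambda>\<alpha> :: 'k hahn. {p. poly p \<alpha> \<in> hahn_nonneg}) hahn_nonneg"
    by (rule inj_onI) (rule hahn_poly_eval_inj)
next
  fix A and \<alpha> :: "'k hahn"
  assume "A = {p. poly p \<alpha> \<in> hahn_nonneg}" "\<alpha> \<in> hahn_nonneg"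
  then show "A \<in> {A. maximal_subalgebra hahn_poly_consts A hahn_poly_ring
      \<and> extending A hahn_poly_ring \<and> hahn_nonneg_polys \<subseteq> A}"
    using is_maximal_subring_hahn_poly_eval[of \<alpha>] subalgebra_hahn_poly_eval[of \<alpha>]
      extending_hahn_poly_eval[of \<alpha>] hahn_poly_eval_nonneg_polys[of \<alpha>]
    by (simp add: maximal_subalgebra_def maximal_subring_ring_of_type_algebra_iff)
next
  fix A :: "'k hahn poly set"
  assume "maximal_subalgebra hahn_poly_consts A hahn_poly_ring" and sub: "hahn_nonneg_polys \<subseteq> A"
  then have max: "is_maximal_subring A"
    by (simp add: maximal_subalgebra_def maximal_subring_ring_of_type_algebra_iff)
  then obtain \<alpha> where \<alpha>: "\<alpha> \<in> hahn_nonneg" "A \<subseteq> {p. poly p \<alpha> \<in> hahn_nonneg}"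
    using is_maximal_subring_hahn_poly sub by blast
  \<comment> \<open>A strict inclusion would make the larger set the whole ring, but that set is
    itself a proper subring.\<close>
  moreover have "\<not> A \<subset> {p. poly p \<alpha> \<in> hahn_nonneg}"
    using max is_maximal_subring_hahn_poly_eval[of \<alpha>] unfolding is_maximal_subring_def by blast
  ultimately show "A \<in> (\<lambda>\<alpha>. {p. poly p \<alpha> \<in> hahn_nonneg}) ` hahn_nonneg" by blast
qed

end
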